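(* Let $X$ be a locally compact Hausdorff space and $k$ a nonnegative symmetric lower semicontinuous kernel on $X$. For any $H,L\subset X$ the dual Chebyshev constant $\overline{M}(H,L)$ coincides with $q^{\#}(H,L)$, i.e. $\overline{M}(H,L)=q^{\#}(H,L)$. Also, the dual statement $M(H,L)=\underline{q}^{\#}(H,L)$ holds true.
   Context: A nonnegative symmetric lower semicontinuous kernel on $X$ is a function $k:X\times X\to[0,+\infty]$ that is lower semicontinuous on $X\times X$ and satisfies $k(x,y)=k(y,x)$ for all $x,y\in X$. For $H\subset X$, $\mathfrak{M}_1^{\#}(H)$ is the set of finitely supported probability measures on $H$, i.e. finite convex combinations of Dirac measures at points of $H$. The potential of $\mu$ is $U^\mu(x)=\int_X k(x,y)\,d\mu(y)\in[0,+\infty]$. All suprema and infima are taken in $[0,+\infty]$. Define $$q^{\#}(H,L)=\inf_{\mu\in\mathfrak{M}_1^{\#}(H)}\sup_{x\in L}U^\mu(x),\qquad \underline{q}^{\#}(H,L)=\sup_{\mu\in\mathfrak{M}_1^{\#}(H)}\inf_{x\in L}U^\mu(x),$$ $$M_n(H,L)=\sup_{w_1,\dots,w_n\in H}\inf_{x\in L}\frac1n\sum_{j=1}^n k(x,w_j),\qquad \overline{M}_n(H,L)=\inf_{w_1,\dots,w_n\in H}\sup_{x\in L}\frac1n\sum_{j=1}^n k(x,w_j)$$ (the points $w_j$ need not be distinct), and $$M(H,L)=\lim_{n\to\infty}M_n(H,L)=\sup_n M_n(H,L),\qquad \overline{M}(H,L)=\lim_{n\to\infty}\overline{M}_n(H,L)=\inf_n\overline{M}_n(H,L)$$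 (these limits exist in $[0,+\infty]$). *)

theory Defs
  imports "HOL-Analysis.Analysis" "HOL-Real_Asymp.Real_Asymp" "HOL-Probability.Probability_Mass_Function"
begin

(* Lower semicontinuity on a topological space: all strict superlevel sets are open. *)
definition lower_semicontinuous_on_topology :: "'a topology \<Rightarrow> ('a \<Rightarrow> ennreal) \<Rightarrow> bool"
  where "lower_semicontinuous_on_topology X f \<longleftrightarrow>
    (\<forall>c. openin X {x \<in> topspace X. c < f x})"

definition symmetric_lsc_kernel :: "'a topology \<Rightarrow> ('a \<Rightarrow> 'a \<Rightarrow> ennreal) \<Rightarrow> bool"
  where "symmetric_lsc_kernel X k \<longleftrightarrow>
    lower_semicontinuous_on_topology (prod_topology X X) (\<lambda>(x, y). k x y) \<and>
    (\<forall>x\<in>topspace X. \<forall>y\<in>topspace X. k x y = k y x)"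

(* A finite convex combination of Dirac measures is a probability mass function with
   finite support. *)
definition finsupp_prob_measures :: "'a set \<Rightarrow> 'a pmf set"
  where "finsupp_prob_measures H = {\<mu>. finite (set_pmf \<mu>) \<and> set_pmf \<mu> \<subseteq> H}"

definition potential :: "('a \<Rightarrow> 'a \<Rightarrow> ennreal) \<Rightarrow> 'a pmf \<Rightarrow> 'a \<Rightarrow> ennreal"
  where "potential k \<mu> x = (\<integral>\<^sup>+ y. k x y \<partial>measure_pmf \<mu>)"

(* Suprema and infima are those of the complete lattice ennreal, so that over the empty
   set they are 0 and \<infinity>, respectively. *)

definition q_upper :: "('a \<Rightarrow> 'a \<Rightarrow> ennreal) \<Rightarrow> 'a set \<Rightarrow> 'a set \<Rightarrow> ennreal"
  where "q_upper k H L = (INF \<mu>\<in>finsupp_prob_measures H. SUP x\<in>L. potential k \<mu> x)"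

definition q_lower :: "('a \<Rightarrow> 'a \<Rightarrow> ennreal) \<Rightarrow> 'a set \<Rightarrow> 'a set \<Rightarrow> ennreal"
  where "q_lower k H L = (SUP \<mu>\<in>finsupp_prob_measures H. INF x\<in>L. potential k \<mu> x)"

(* The points w_1, ..., w_n are indexed by 0, ..., n - 1. *)

definition chebyshev_n ::
    "nat \<Rightarrow> ('a \<Rightarrow> 'a \<Rightarrow> ennreal) \<Rightarrow> 'a set \<Rightarrow> 'a set \<Rightarrow> ennreal"
  where "chebyshev_n n k H L =
    (SUP w\<in>{..<n} \<rightarrow> H. INF x\<in>L. (1 / of_nat n) * (\<Sum>j<n. k x (w j)))"

definition dual_chebyshev_n ::
    "nat \<Rightarrow> ('a \<Rightarrow> 'a \<Rightarrow> ennreal) \<Rightarrow> 'a set \<Rightarrow> 'a set \<Rightarrow> ennreal"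
  where "dual_chebyshev_n n k H L =
    (INF w\<in>{..<n} \<rightarrow> H. SUP x\<in>L. (1 / of_nat n) * (\<Sum>j<n. k x (w j)))"

definition chebyshev_const :: "('a \<Rightarrow> 'a \<Rightarrow> ennreal) \<Rightarrow> 'a set \<Rightarrow> 'a set \<Rightarrow> ennreal"
  where "chebyshev_const k H L = lim (\<lambda>n. chebyshev_n n k H L)"

definition dual_chebyshev_const :: "('a \<Rightarrow> 'a \<Rightarrow> ennreal) \<Rightarrow> 'a set \<Rightarrow> 'a set \<Rightarrow> ennreal"
  where "dual_chebyshev_const k H L = lim (\<lambda>n. dual_chebyshev_n n k H L)"

(* The limits above exist, and equal the supremum resp. infimum over n \<ge> 1. *)

lemma sum_lessThan_split:
  fixes f :: "nat \<Rightarrow> ennreal"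
  shows "(\<Sum>j<a + m. f j) = (\<Sum>j<a. f j) + (\<Sum>j<m. f (a + j))"
  by (induction m) (auto simp: add.assoc)

lemma sum_periodic:
  fixes f :: "nat \<Rightarrow> ennreal"
  shows "(\<Sum>j<q * m. f (j mod m)) = of_nat q * (\<Sum>j<m. f j)"
proof (induction q)
  case (Suc q)
  have "(\<Sum>j<Suc q * m. f (j mod m)) = (\<Sum>j<q * m + m. f (j mod m))"
    by (simp add: add.commute)
  also have "\<dots> = (\<Sum>j<q * m. f (j mod m)) + (\<Sum>j<m. f ((q * m + j) mod m))"
    by (simp add: sum_lessThan_split)
  also have "(\<Sum>j<m. f ((q * m + j) mod m)) = (\<Sum>j<m. f j)"
    by (intro sum.cong) auto
  finally show ?case
    using Suc by (simp add: distrib_right add.commute)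
qed simp

lemma average_scale:
  assumes "m > 0" "n > 0"
  shows "ennreal (real q * real m / real n) * ((1 / of_nat m) * s) = (1 / of_nat n) * (of_nat q * s)"
proof -
  have "(1 / of_nat m :: ennreal) = ennreal (1 / real m)" "(1 / of_nat n :: ennreal) = ennreal (1 / real n)"
    using assms by (auto simp: divide_ennreal ennreal_of_nat_eq_real_of_nat simp flip: ennreal_1)
  moreover have "real q * real m / real n * (1 / real m) = 1 / real n * real q"
    using assms by simp
  ultimately show ?thesis
    by (simp add: ennreal_of_nat_eq_real_of_nat mult.assoc[symmetric] flip: ennreal_mult'')
qed

lemma average_periodic_lower:
  fixes f :: "nat \<Rightarrow> ennreal"
  assumes "m > 0" "n > 0"
  shows "ennreal ((real n - real m) / real n) * ((1 / of_nat m) * (\<Sum>j<m. f j))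
    \<le> (1 / of_nat n) * (\<Sum>j<n. f (j mod m))"
proof -
  define q where "q = n div m"
  have n: "n = q * m + n mod m" by (simp add: q_def)
  have "n mod m < m" using assms by simp
  then have "real n - real m \<le> real q * real m"
    using n by (simp add: algebra_simps flip: of_nat_mult of_nat_add)
  then have "ennreal ((real n - real m) / real n) * ((1 / of_nat m) * (\<Sum>j<m. f j))
    \<le> ennreal (real q * real m / real n) * ((1 / of_nat m) * (\<Sum>j<m. f j))"
    by (intro mult_right_mono ennreal_leI divide_right_mono) auto
  also have "\<dots> = (1 / of_nat n) * (\<Sum>j<q * m. f (j mod m))"
    using assms by (simp only: average_scale sum_periodic)
  also have "\<dots> \<le> (1 / of_nat n) * (\<Sum>j<n. f (j mod m))"
    using n by (intro mult_left_mono sum_mono2) auto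
  finally show ?thesis .
qed

lemma average_periodic_upper:
  fixes f :: "nat \<Rightarrow> ennreal"
  assumes "m > 0" "n > 0"
  shows "(1 / of_nat n) * (\<Sum>j<n. f (j mod m))
    \<le> ennreal ((real n + real m) / real n) * ((1 / of_nat m) * (\<Sum>j<m. f j))"
proof -
  define q where "q = Suc (n div m)"
  have qm: "q * m = n - n mod m + m"
    by (simp add: q_def minus_mod_eq_div_mult)
  have "n mod m < m" using assms by simp
  with qm have n: "n \<le> q * m" "q * m \<le> n + m" by auto
  have "(1 / of_nat n) * (\<Sum>j<n. f (j mod m)) \<le> (1 / of_nat n) * (\<Sum>j<q * m. f (j mod m))"
    using n by (intro mult_left_mono sum_mono2) auto
  also have "\<dots> = ennreal (real q * real m / real n) * ((1 / of_nat m) * (\<Sum>j<m. f j))"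
    using assms by (simp only: average_scale sum_periodic)
  also have "\<dots> \<le> ennreal ((real n + real m) / real n) * ((1 / of_nat m) * (\<Sum>j<m. f j))"
    using n(2) by (intro mult_right_mono ennreal_leI divide_right_mono)
      (auto simp flip: of_nat_mult of_nat_add)
  finally show ?thesis .
qed

lemma tendsto_scale_ennreal:
  assumes "r \<longlonglongrightarrow> (1::real)"
  shows "(\<lambda>n. ennreal (r n) * c) \<longlonglongrightarrow> c"
proof -
  have "(\<lambda>n. ennreal (r n) * c) \<longlonglongrightarrow> ennreal 1 * c"
    by (intro tendsto_mult_ennreal tendsto_ennrealI assms tendsto_const) auto
  then show ?thesis by simp
qed

lemma chebyshev_n_tendsto_SUP:
  "(\<lambda>n. chebyshev_n n k H L) \<longlonglongrightarrow> (SUP n\<in>{1..}. chebyshev_n n k H L)"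
proof (rule order_tendstoI)
  fix c assume "c < (SUP n\<in>{1..}. chebyshev_n n k H L)"
  then obtain m w where m: "m \<ge> 1" and w: "w \<in> {..<m} \<rightarrow> H"
    and c: "c < (INF x\<in>L. (1 / of_nat m) * (\<Sum>j<m. k x (w j)))" (is "_ < ?I")
    by (auto simp: less_SUP_iff chebyshev_n_def)
  have bound: "ennreal ((real n - real m) / real n) * ?I \<le> chebyshev_n n k H L" if "n > 0" for n
  proof -
    have w': "(\<lambda>j. w (j mod m)) \<in> {..<n} \<rightarrow> H"
      using m w by auto
    have "ennreal ((real n - real m) / real n) * ?I
        \<le> (INF x\<in>L. (1 / of_nat n) * (\<Sum>j<n. k x (w (j mod m))))"
    proof (rule INF_greatest)
      fix x assume "x \<in> L"
      then have "ennreal ((real n - real m) / real n) * ?I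
          \<le> ennreal ((real n - real m) / real n) * ((1 / of_nat m) * (\<Sum>j<m. k x (w j)))"
        by (intro mult_left_mono INF_lower) auto
      also have "\<dots> \<le> (1 / of_nat n) * (\<Sum>j<n. k x (w (j mod m)))"
        using m that by (intro average_periodic_lower) auto
      finally show "ennreal ((real n - real m) / real n) * ?I
          \<le> (1 / of_nat n) * (\<Sum>j<n. k x (w (j mod m)))" .
    qed
    also have "\<dots> \<le> chebyshev_n n k H L"
      unfolding chebyshev_n_def by (rule SUP_upper[OF w'])
    finally show ?thesis .
  qed
  have "(\<lambda>n. (real n - real m) / real n) \<longlonglongrightarrow> 1"
    by real_asymp
  from order_tendstoD(1)[OF tendsto_scale_ennreal[OF this] c] eventually_gt_at_top[of 0]
  show "\<forall>\<^sub>F n in sequentially. c < chebyshev_n n k H L"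
    by eventually_elim (use bound in \<open>blast intro: less_le_trans\<close>)
next
  fix c assume "(SUP n\<in>{1..}. chebyshev_n n k H L) < c"
  moreover have "chebyshev_n n k H L \<le> (SUP n\<in>{1..}. chebyshev_n n k H L)" if "n \<ge> 1" for n
    using that by (intro SUP_upper) simp
  ultimately show "\<forall>\<^sub>F n in sequentially. chebyshev_n n k H L < c"
    by (meson eventually_sequentiallyI le_less_trans)
qed

lemma dual_chebyshev_n_tendsto_INF:
  "(\<lambda>n. dual_chebyshev_n n k H L) \<longlonglongrightarrow> (INF n\<in>{1..}. dual_chebyshev_n n k H L)"
proof (rule order_tendstoI)
  fix c assume "(INF n\<in>{1..}. dual_chebyshev_n n k H L) < c"
  then obtain m w where m: "m \<ge> 1" and w: "w \<in> {..<m} \<rightarrow> H"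
    and c: "(SUP x\<in>L. (1 / of_nat m) * (\<Sum>j<m. k x (w j))) < c" (is "?S < _")
    by (auto simp: INF_less_iff dual_chebyshev_n_def)
  have bound: "dual_chebyshev_n n k H L \<le> ennreal ((real n + real m) / real n) * ?S" if "n > 0" for n
  proof -
    have w': "(\<lambda>j. w (j mod m)) \<in> {..<n} \<rightarrow> H"
      using m w by auto
    have "dual_chebyshev_n n k H L \<le> (SUP x\<in>L. (1 / of_nat n) * (\<Sum>j<n. k x (w (j mod m))))"
      unfolding dual_chebyshev_n_def by (rule INF_lower[OF w'])
    also have "\<dots> \<le> ennreal ((real n + real m) / real n) * ?S"
    proof (rule SUP_least)
      fix x assume x: "x \<in> L"
      have "(1 / of_nat n) * (\<Sum>j<n. k x (w (j mod m)))
          \<le> ennreal ((real n + real m) / real n) * ((1 / of_nat m) * (\<Sum>j<m. k x (w j)))"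
        using m that by (intro average_periodic_upper) auto
      also have "\<dots> \<le> ennreal ((real n + real m) / real n) * ?S"
        using x by (intro mult_left_mono SUP_upper) auto
      finally show "(1 / of_nat n) * (\<Sum>j<n. k x (w (j mod m)))
          \<le> ennreal ((real n + real m) / real n) * ?S" .
    qed
    finally show ?thesis .
  qed
  have "(\<lambda>n. (real n + real m) / real n) \<longlonglongrightarrow> 1"
    by real_asymp
  from order_tendstoD(2)[OF tendsto_scale_ennreal[OF this] c] eventually_gt_at_top[of 0]
  show "\<forall>\<^sub>F n in sequentially. dual_chebyshev_n n k H L < c"
    by eventually_elim (use bound in \<open>blast intro: le_less_trans\<close>)
next
  fix c assume "c < (INF n\<in>{1..}. dual_chebyshev_n n k H L)"
  moreover have "(INF n\<in>{1..}. dual_chebyshev_n n k H L) \<le> dual_chebyshev_n n k H L" if "n \<ge> 1" for n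
    using that by (intro INF_lower) simp
  ultimately show "\<forall>\<^sub>F n in sequentially. c < dual_chebyshev_n n k H L"
    by (meson eventually_sequentiallyI less_le_trans)
qed

lemma chebyshev_const_eq_SUP: "chebyshev_const k H L = (SUP n\<in>{1..}. chebyshev_n n k H L)"
  unfolding chebyshev_const_def by (rule limI[OF chebyshev_n_tendsto_SUP])

lemma dual_chebyshev_const_eq_INF:
  "dual_chebyshev_const k H L = (INF n\<in>{1..}. dual_chebyshev_n n k H L)"
  unfolding dual_chebyshev_const_def by (rule limI[OF dual_chebyshev_n_tendsto_INF])

end

theory Submission
  imports Defs
begin

text \<open>
  An \<open>n\<close>-tuple is a probability measure whose weights are multiples of \<open>1/n\<close>, so one inequality
  of each pair is immediate. Conversely, round the weights \<open>N * pmf \<mu> y\<close> up (for the dual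
  constant) or down to integers \<open>c y\<close>. The relative error is at most \<open>1 / (N * d)\<close>, where \<open>d\<close>
  is the least weight of \<open>\<mu>\<close>. A relative error in the weights passes to the potential
  uniformly in \<open>x\<close>, also where the potential is infinite, and vanishes as \<open>N\<close> grows.
\<close>

text \<open>Enumerate the disjoint union of the index sets \<open>{..<c y}\<close>, so that each
  \<open>y\<close> is listed \<open>c y\<close> times. The tuple is chosen before \<open>f\<close>:
  later \<open>f\<close> is \<open>k x\<close>, and a single \<open>w\<close> has to serve all
  \<open>x\<close> in \<open>L\<close>.\<close>

lemma exists_tuple_with_multiplicities:
  fixes c :: "'a \<Rightarrow> nat"
  assumes "finite S"
  obtains w where "w \<in> {..<sum c S} \<rightarrow> S"
    "\<And>f :: 'a \<Rightarrow> ennreal. (\<Sum>j<sum c S. f (w j)) = (\<Sum>y\<in>S. of_nat (c y) * f y)"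
proof -
  let ?P = "SIGMA y:S. {..<c y}"
  have "finite ?P" "card ?P = sum c S"
    using assms by auto
  then obtain h where h: "bij_betw h {..<sum c S} ?P"
    by (metis ex_bij_betw_nat_finite atLeast0LessThan)
  have "(\<Sum>j<sum c S. f (fst (h j))) = (\<Sum>y\<in>S. of_nat (c y) * f y)" for f :: "'a \<Rightarrow> ennreal"
  proof -
    have "(\<Sum>j<sum c S. f (fst (h j))) = (\<Sum>p\<in>?P. f (fst p))"
      using h by (rule sum.reindex_bij_betw)
    also have "\<dots> = (\<Sum>y\<in>S. \<Sum>i<c y. f y)"
      using assms by (subst sum.Sigma) (auto simp: case_prod_beta)
    finally show ?thesis by simp
  qed
  moreover have "(\<lambda>j. fst (h j)) \<in> {..<sum c S} \<rightarrow> S"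
    using bij_betwE[OF h] by (force simp: Pi_iff mem_Times_iff Sigma_def)
  ultimately show ?thesis using that[of "\<lambda>j. fst (h j)"] by blast
qed

lemma one_divide_of_nat_times_of_nat_ennreal:
  assumes "n > 0"
  shows "1 / of_nat n * of_nat m = ennreal (real m / real n)"
proof -
  have "(1 / of_nat n :: ennreal) = ennreal (1 / real n)"
    using assms by (auto simp: divide_ennreal ennreal_of_nat_eq_real_of_nat simp flip: ennreal_1)
  then show ?thesis
    by (simp add: ennreal_of_nat_eq_real_of_nat flip: ennreal_mult'')
qed

text \<open>The uniform measure is taken on the indices and pushed forward by \<open>w\<close>, so a
  point that occurs several times in the tuple gets the corresponding multiple of
  \<open>1/n\<close>. For \<open>n = 0\<close> there is no uniform measure on the indices.\<close>

lemma potential_uniform_tuple: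
  assumes "n > 0"
  shows "potential k (map_pmf w (pmf_of_set {..<n})) x = 1 / of_nat n * (\<Sum>j<n. k x (w j))"
  using assms
  by (simp add: potential_def nn_integral_pmf_of_set lessThan_empty_iff divide_ennreal_def mult.commute
      ennreal_of_nat_eq_real_of_nat)

lemma uniform_tuple_in_finsupp_prob_measures:
  fixes n :: nat
  assumes "n > 0" "w \<in> {..<n} \<rightarrow> H"
  shows "map_pmf w (pmf_of_set {..<n}) \<in> finsupp_prob_measures H"
  using assms by (auto simp: finsupp_prob_measures_def lessThan_empty_iff)

text \<open>Each tuple average is the potential of an admissible measure, so \<open>q_upper\<close>
  is an infimum over a larger family.\<close>

lemma q_upper_le_dual_chebyshev_const: "q_upper k H L \<le> dual_chebyshev_const k H L"
  unfolding dual_chebyshev_const_eq_INF dual_chebyshev_n_def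
proof (intro INF_greatest)
  fix n :: nat and w assume "n \<in> {1..}" "w \<in> {..<n} \<rightarrow> H"
  then have "q_upper k H L \<le> (SUP x\<in>L. potential k (map_pmf w (pmf_of_set {..<n})) x)"
    unfolding q_upper_def by (intro INF_lower uniform_tuple_in_finsupp_prob_measures) auto
  with \<open>n \<in> {1..}\<close> show "q_upper k H L \<le> (SUP x\<in>L. 1 / of_nat n * (\<Sum>j<n. k x (w j)))"
    by (simp add: potential_uniform_tuple)
qed

lemma chebyshev_const_le_q_lower: "chebyshev_const k H L \<le> q_lower k H L"
  unfolding chebyshev_const_eq_SUP chebyshev_n_def
proof (intro SUP_least)
  fix n :: nat and w assume "n \<in> {1..}" "w \<in> {..<n} \<rightarrow> H"
  then have "(INF x\<in>L. potential k (map_pmf w (pmf_of_set {..<n})) x) \<le> q_lower k H L"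
    unfolding q_lower_def by (intro SUP_upper uniform_tuple_in_finsupp_prob_measures) auto
  with \<open>n \<in> {1..}\<close> show "(INF x\<in>L. 1 / of_nat n * (\<Sum>j<n. k x (w j))) \<le> q_lower k H L"
    by (simp add: potential_uniform_tuple)
qed

text \<open>With the factor \<open>r\<close> absorbed into the weights, scaled potentials and tuple
  averages can be compared coefficient by coefficient.\<close>

lemma potential_finite_support:
  assumes "finite (set_pmf \<mu>)"
  shows "ennreal r * potential k \<mu> x
    = (\<Sum>y\<in>set_pmf \<mu>. ennreal (r * pmf \<mu> y) * k x y)"
  using assms
  by (simp add: potential_def nn_integral_measure_pmf_finite sum_distrib_left ennreal_mult'' mult_ac)

text \<open>The tuple that lists \<open>y\<close> exactly \<open>c y\<close> times has weights
  \<open>c y / n\<close>. As the kernel is nonnegative, domination of the weights gives domination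
  of the potentials at every \<open>x\<close>, infinite values included. An additive error in the
  weights would not do, since \<open>k\<close> may be unbounded or infinite.\<close>

lemma dual_chebyshev_const_le_scaled_potential:
  assumes \<mu>: "\<mu> \<in> finsupp_prob_measures H" and "n > 0" and n: "n = sum c (set_pmf \<mu>)"
    and c: "\<And>y. y \<in> set_pmf \<mu> \<Longrightarrow> real (c y) / real n \<le> r * pmf \<mu> y"
  shows "dual_chebyshev_const k H L \<le> ennreal r * (SUP x\<in>L. potential k \<mu> x)"
proof -
  from \<mu> have fin: "finite (set_pmf \<mu>)" and H: "set_pmf \<mu> \<subseteq> H"
    by (auto simp: finsupp_prob_measures_def)
  from fin obtain w where w: "w \<in> {..<n} \<rightarrow> set_pmf \<mu>"
    and sum_w: "\<And>f :: 'a \<Rightarrow> ennreal. (\<Sum>j<n. f (w j)) = (\<Sum>y\<in>set_pmf \<mu>. of_nat (c y) * f y)"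
    unfolding n using exists_tuple_with_multiplicities by blast
  have "dual_chebyshev_const k H L \<le> dual_chebyshev_n n k H L"
    unfolding dual_chebyshev_const_eq_INF using \<open>n > 0\<close> by (intro INF_lower) simp
  also have "\<dots> \<le> (SUP x\<in>L. 1 / of_nat n * (\<Sum>j<n. k x (w j)))"
    unfolding dual_chebyshev_n_def using w H by (intro INF_lower) auto
  also have "\<dots> \<le> (SUP x\<in>L. ennreal r * potential k \<mu> x)"
  proof (intro SUP_mono')
    fix x
    have "1 / of_nat n * (\<Sum>j<n. k x (w j))
        = (\<Sum>y\<in>set_pmf \<mu>. ennreal (real (c y) / real n) * k x y)"
      using one_divide_of_nat_times_of_nat_ennreal[OF \<open>n > 0\<close>]
      by (simp add: sum_w sum_distrib_left flip: mult.assoc)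
    also have "\<dots> \<le> ennreal r * potential k \<mu> x"
      unfolding potential_finite_support[OF fin]
      using c by (intro sum_mono mult_right_mono ennreal_leI) auto
    finally show "1 / of_nat n * (\<Sum>j<n. k x (w j)) \<le> ennreal r * potential k \<mu> x" .
  qed
  also have "\<dots> \<le> ennreal r * (SUP x\<in>L. potential k \<mu> x)"
    by (intro SUP_least mult_left_mono SUP_upper) auto
  finally show ?thesis .
qed

lemma scaled_potential_le_chebyshev_const:
  assumes \<mu>: "\<mu> \<in> finsupp_prob_measures H" and "n > 0" and n: "n = sum c (set_pmf \<mu>)"
    and c: "\<And>y. y \<in> set_pmf \<mu> \<Longrightarrow> r * pmf \<mu> y \<le> real (c y) / real n"
  shows "ennreal r * (INF x\<in>L. potential k \<mu> x) \<le> chebyshev_const k H L"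
proof -
  from \<mu> have fin: "finite (set_pmf \<mu>)" and H: "set_pmf \<mu> \<subseteq> H"
    by (auto simp: finsupp_prob_measures_def)
  from fin obtain w where w: "w \<in> {..<n} \<rightarrow> set_pmf \<mu>"
    and sum_w: "\<And>f :: 'a \<Rightarrow> ennreal. (\<Sum>j<n. f (w j)) = (\<Sum>y\<in>set_pmf \<mu>. of_nat (c y) * f y)"
    unfolding n using exists_tuple_with_multiplicities by blast
  \<comment> \<open>Equality can fail here: for empty \<open>L\<close> and \<open>r = 0\<close> the
    left side is 0 and the right side is infinite.\<close>
  have "ennreal r * (INF x\<in>L. potential k \<mu> x) \<le> (INF x\<in>L. ennreal r * potential k \<mu> x)"
    by (intro INF_greatest mult_left_mono INF_lower) auto
  also have "\<dots> \<le> (INF x\<in>L. 1 / of_nat n * (\<Sum>j<n. k x (w j)))"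
  proof (intro INF_mono')
    fix x
    have "ennreal r * potential k \<mu> x
        \<le> (\<Sum>y\<in>set_pmf \<mu>. ennreal (real (c y) / real n) * k x y)"
      unfolding potential_finite_support[OF fin]
      using c by (intro sum_mono mult_right_mono ennreal_leI) auto
    also have "\<dots> = 1 / of_nat n * (\<Sum>j<n. k x (w j))"
      using one_divide_of_nat_times_of_nat_ennreal[OF \<open>n > 0\<close>]
      by (simp add: sum_w sum_distrib_left flip: mult.assoc)
    finally show "ennreal r * potential k \<mu> x \<le> 1 / of_nat n * (\<Sum>j<n. k x (w j))" .
  qed
  also have "\<dots> \<le> chebyshev_n n k H L"
    unfolding chebyshev_n_def using w H by (intro SUP_upper) auto
  also have "\<dots> \<le> chebyshev_const k H L"
    unfolding chebyshev_const_eq_SUP using \<open>n > 0\<close> by (intro SUP_upper) simp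
  finally show ?thesis .
qed

text \<open>The least weight \<open>d\<close> turns the additive rounding error \<open>1/N\<close>
  into a relative one, because \<open>1/N = 1/(N * d) * d\<close> and \<open>d\<close> is at most
  \<open>pmf \<mu> y\<close>.\<close>

lemma pmf_finite_support_lower_bound:
  assumes "finite (set_pmf \<mu>)"
  obtains d where "d > 0" "\<And>y. y \<in> set_pmf \<mu> \<Longrightarrow> d \<le> pmf \<mu> y"
proof
  show "Min (pmf \<mu> ` set_pmf \<mu>) > 0"
    using assms by (simp add: set_pmf_not_empty pmf_positive)
  show "Min (pmf \<mu> ` set_pmf \<mu>) \<le> pmf \<mu> y" if "y \<in> set_pmf \<mu>" for y
    using assms that by simp
qed

lemma dual_chebyshev_const_le_q_upper: "dual_chebyshev_const k H L \<le> q_upper k H L"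
  unfolding q_upper_def
proof (rule INF_greatest)
  fix \<mu> assume \<mu>: "\<mu> \<in> finsupp_prob_measures H"
  let ?S = "set_pmf \<mu>"
  have fin: "finite ?S"
    using \<mu> by (simp add: finsupp_prob_measures_def)
  then obtain d where d: "d > 0" "\<And>y. y \<in> ?S \<Longrightarrow> d \<le> pmf \<mu> y"
    using pmf_finite_support_lower_bound by blast
  have bound: "dual_chebyshev_const k H L
      \<le> ennreal (1 + 1 / (real N * d)) * (SUP x\<in>L. potential k \<mu> x)" if N: "N > 0" for N
  proof (rule dual_chebyshev_const_le_scaled_potential[OF \<mu> _ refl])
    \<comment> \<open>Rounding up makes the total count at least \<open>N\<close>, so the true
      weights \<open>c y / sum c ?S\<close> are at most \<open>c y / N\<close>.\<close>
    define c where "c y = nat \<lceil>real N * pmf \<mu> y\<rceil>" for y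
    have "real N = (\<Sum>y\<in>?S. real N * pmf \<mu> y)"
      using sum_pmf_eq_1[OF fin order_refl] by (simp flip: sum_distrib_left)
    also have "\<dots> \<le> real (sum c ?S)"
      by (simp add: c_def sum_mono)
    finally have n: "N \<le> sum c ?S"
      by (simp only: of_nat_le_iff)
    with N show "sum c ?S > 0" by linarith
    fix y assume y: "y \<in> ?S"
    have "real (c y) / real (sum c ?S) \<le> real (c y) / real N"
      using n N by (intro frac_le) (auto simp del: of_nat_sum)
    also have "real (c y) \<le> real N * pmf \<mu> y + 1"
      by (simp add: c_def of_nat_nat)
    also have "(real N * pmf \<mu> y + 1) / real N = pmf \<mu> y + 1 / (real N * d) * d"
      using N d(1) by (simp add: field_simps)
    also have "\<dots> \<le> pmf \<mu> y + 1 / (real N * d) * pmf \<mu> y"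
      using N d y by (intro add_left_mono mult_left_mono) auto
    finally show "real (c y) / real (sum c ?S) \<le> (1 + 1 / (real N * d)) * pmf \<mu> y"
      using N by (simp add: divide_right_mono distrib_right)
  qed
  have "(\<lambda>N. 1 + 1 / (real N * d)) \<longlonglongrightarrow> 1"
    using d(1) by real_asymp
  \<comment> \<open>Let \<open>N\<close> tend to infinity. The factor tends to 1, which is not 0, so
    the limit is also valid for an infinite supremum.\<close>
  then show "dual_chebyshev_const k H L \<le> (SUP x\<in>L. potential k \<mu> x)"
    using bound by (intro LIMSEQ_le_const[OF tendsto_scale_ennreal] exI[of _ 1]) auto
qed

lemma q_lower_le_chebyshev_const: "q_lower k H L \<le> chebyshev_const k H L"
  unfolding q_lower_def
proof (rule SUP_least)
  fix \<mu> assume \<mu>: "\<mu> \<in> finsupp_prob_measures H"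
  let ?S = "set_pmf \<mu>"
  have fin: "finite ?S"
    using \<mu> by (simp add: finsupp_prob_measures_def)
  then obtain d where d: "d > 0" "\<And>y. y \<in> ?S \<Longrightarrow> d \<le> pmf \<mu> y"
    using pmf_finite_support_lower_bound by blast
  have bound: "ennreal (1 - 1 / (real N * d)) * (INF x\<in>L. potential k \<mu> x)
      \<le> chebyshev_const k H L" if N: "real N > 1 / d" for N
  proof (rule scaled_potential_le_chebyshev_const[OF \<mu> _ refl])
    define c where "c y = nat \<lfloor>real N * pmf \<mu> y\<rfloor>" for y
    have "N > 0"
      using N d(1) by (metis gr0I less_asym of_nat_0 zero_less_divide_1_iff)
    \<comment> \<open>Hence \<open>N * pmf \<mu> y\<close> is at least 1 on the support, and
      rounding down leaves every multiplicity positive; without this the tuple could be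
      empty.\<close>
    have Nd: "real N * d > 1"
      using N d(1) by (simp add: field_simps)
    have "c y > 0" if "y \<in> ?S" for y
    proof -
      have "1 \<le> real N * pmf \<mu> y"
        using Nd mult_left_mono[OF d(2)[OF that], of "real N"] by simp
      then show ?thesis by (simp add: c_def)
    qed
    then show pos: "sum c ?S > 0"
      using fin by (intro sum_pos) (auto simp: set_pmf_not_empty)
    have "real (sum c ?S) \<le> (\<Sum>y\<in>?S. real N * pmf \<mu> y)"
      by (simp add: c_def sum_mono)
    also have "\<dots> = real N"
      using sum_pmf_eq_1[OF fin order_refl] by (simp flip: sum_distrib_left)
    finally have n: "sum c ?S \<le> N"
      by (simp only: of_nat_le_iff)
    fix y assume y: "y \<in> ?S"
    have "(1 - 1 / (real N * d)) * pmf \<mu> y = pmf \<mu> y - 1 / (real N * d) * pmf \<mu> y"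
      by (simp add: algebra_simps)
    also have "\<dots> \<le> pmf \<mu> y - 1 / (real N * d) * d"
      using d y by (intro diff_left_mono mult_left_mono) auto
    also have "\<dots> = (real N * pmf \<mu> y - 1) / real N"
      using \<open>N > 0\<close> d(1) by (simp add: field_simps)
    also have "\<dots> \<le> real (c y) / real N"
    proof (intro divide_right_mono)
      show "real N * pmf \<mu> y - 1 \<le> real (c y)"
        unfolding c_def by linarith
    qed simp
    \<comment> \<open>Rounding down makes the total count at most \<open>N\<close>, so passing to
      the true denominator only increases the weights.\<close>
    also have "\<dots> \<le> real (c y) / real (sum c ?S)"
      using n pos by (intro frac_le) (auto simp del: of_nat_sum)
    finally show "(1 - 1 / (real N * d)) * pmf \<mu> y \<le> real (c y) / real (sum c ?S)" .
  qed
  obtain N0 :: nat where "real N0 > 1 / d"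
    using reals_Archimedean2 by blast
  then have "real N > 1 / d" if "N \<ge> N0" for N
    using that by (meson less_le_trans of_nat_le_iff)
  moreover have "(\<lambda>N. 1 - 1 / (real N * d)) \<longlonglongrightarrow> 1"
    using d(1) by real_asymp
  ultimately show "(INF x\<in>L. potential k \<mu> x) \<le> chebyshev_const k H L"
    using bound by (intro LIMSEQ_le_const2[OF tendsto_scale_ennreal] exI[of _ N0]) auto
qed

theorem proposition4p5:
  fixes X :: "'a topology" and k :: "'a \<Rightarrow> 'a \<Rightarrow> ennreal" and H L :: "'a set"
  assumes "locally_compact_space X" and "Hausdorff_space X"
    and "symmetric_lsc_kernel X k"
    and "H \<subseteq> topspace X" and "L \<subseteq> topspace X"
  shows "dual_chebyshev_const k H L = q_upper k H L \<and> chebyshev_const k H L = q_lower k H L"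
  by (intro conjI antisym dual_chebyshev_const_le_q_upper q_upper_le_dual_chebyshev_const
      chebyshev_const_le_q_lower q_lower_le_chebyshev_const)

end
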